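(* There exist two infinite binary words $\mathbf x$ and $\mathbf y$ such that neither $\mathbf x$ nor $\mathbf y$ contains a square $ww$ with $|w|\ge 4$, but their perfect shuffle $\mathbf x \,\mathrm{SH}\, \mathbf y$ contains arbitrarily large squares.
   Context: For words $\mathbf x=a_1a_2a_3\cdots$ and $\mathbf y=b_1b_2b_3\cdots$, the perfect shuffle is $\mathbf x\,\mathrm{SH}\,\mathbf y=a_1b_1a_2b_2a_3b_3\cdots$. A square is a nonempty word $ww$ occurring as a contiguous subword. *)

theory Defs
  imports Main "HOL-Library.Omega_Words_Fun"
begin

(* Infinite words are indexed from 0, so the letters of x sit at the even positions of the
   shuffle and the letters of y at the odd positions. *)
definition perfect_shuffle :: "'a word \<Rightarrow> 'a word \<Rightarrow> 'a word"  (infixl \<open>SH\<close> 65) where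
  "x SH y = (\<lambda>n. if even n then x (n div 2) else y (n div 2))"

definition contiguous_subword :: "'a list \<Rightarrow> 'a word \<Rightarrow> bool" where
  "contiguous_subword u x \<longleftrightarrow> (\<exists>i j. u = subsequence x i j)"

definition contains_square :: "'a word \<Rightarrow> 'a list \<Rightarrow> bool" where
  "contains_square x w \<longleftrightarrow> w \<noteq> [] \<and> contiguous_subword (w @ w) x"

end

theory Submission
  imports Defs "HOL-Library.Discrete_Functions"
begin

text \<open>
  A square of odd period \<open>2k + 1\<close> at an even position of the shuffle means that \<open>x\<close> contains \<open>uv\<close>
  where \<open>y\<close> contains \<open>vu\<close>, with \<open>|u| = k + 1\<close> and \<open>|v| = k\<close>. Both words are images of square-free
  words under a code whose blocks have odd length 9, and \<open>y\<close> is shifted by half a block.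
  Let \<open>s\<close> be a two-sided square-free word over four letters and \<open>d\<close> a fifth letter. Then
  \<open>x\<close> encodes \<open>s[0..i) d s[-i..0)\<close> for \<open>i = 1, 2, \<dots>\<close> in succession and \<open>y\<close> encodes \<open>d s[-i..i)\<close>.
  Cutting the encoded \<open>d\<close> in the middle gives the required \<open>u\<close> and \<open>v\<close> for every \<open>i\<close>.
  The two preimages are square-free since the distances between consecutive \<open>d\<close>'s increase and the
  factor of \<open>s\<close> between them grows by one letter on either side.

  For \<open>s\<close> take the paperfolding word, which has no square of even period, and attach to each
  letter the parity of its position, which rules out the odd periods.
\<close>

section \<open>Squares as a local periodicity\<close>

text \<open>The index type stays generic so that both one-sided words over \<open>nat\<close> and
  two-sided words over \<open>int\<close> are covered.\<close>

definition square_from :: "('i::linordered_semidom \<Rightarrow> 'a) \<Rightarrow> 'i \<Rightarrow> 'i \<Rightarrow> bool" where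
  "square_from w t p \<longleftrightarrow> 0 < p \<and> (\<forall>k. t \<le> k \<longrightarrow> k < t + p \<longrightarrow> w k = w (k + p))"

lemma square_fromD:
  "square_from w t p \<Longrightarrow> t \<le> k \<Longrightarrow> k < t + p \<Longrightarrow> w k = w (k + p)"
  by (simp add: square_from_def)

lemma contains_square_imp_square_from:
  assumes "contains_square x w"
  shows "\<exists>t. square_from x t (length w)"
proof -
  obtain i j where ij: "w @ w = map x [i..<j]" and "w \<noteq> []"
    using assms by (auto simp: contains_square_def contiguous_subword_def subsequence_def)
  have len: "j - i = 2 * length w"
    using arg_cong[OF ij, of length] by simp
  have nth: "(w @ w) ! k = x (i + k)" if "k < 2 * length w" for k
    using that len by (simp add: ij)
  have "x (i + m) = x (i + m + length w)" if "m < length w" for m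
    using that nth[of m] nth[of "m + length w"] by (simp add: nth_append add.assoc)
  then have "x k = x (k + length w)" if "i \<le> k" "k < i + length w" for k
    using that by (metis add_less_cancel_left le_Suc_ex)
  with \<open>w \<noteq> []\<close> show ?thesis by (auto simp: square_from_def)
qed

lemma square_from_imp_contains_square:
  assumes "square_from x t p"
  shows "contains_square x (map x [t..<t + p])"
proof -
  have "map x [t + p..<t + p + p] = map x [t..<t + p]"
    using assms by (intro nth_equalityI) (auto simp: square_from_def add_ac)
  then have "map x [t..<t + p] @ map x [t..<t + p] = map x [t..<t + p + p]"
    by (simp add: upt_add_eq_append[of t "t + p" p])
  then show ?thesis
    using assms
    by (auto simp: contains_square_def contiguous_subword_def subsequence_def square_from_def)
qed


section \<open>A two-sided square-free word over four letters\<close>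

text \<open>The recursion \<open>paperfold (2 n + 1) = paperfold n\<close> leaves the value at \<open>-1\<close> free.\<close>

function paperfold :: "int \<Rightarrow> bool" where
  "paperfold n =
    (if n = -1 then False else if even n then even (n div 2) else paperfold (n div 2))"
  by auto
termination by (relation "measure (\<lambda>n. nat \<bar>n\<bar>)") (auto elim!: oddE, presburger)

declare paperfold.simps [simp del]

lemma paperfold_even: "paperfold (2 * m) \<longleftrightarrow> even m"
  by (subst paperfold.simps) (auto, presburger+)

lemma paperfold_odd: "paperfold (2 * m + 1) = paperfold m"
proof (cases "m = -1")
  case False
  then show ?thesis by (subst paperfold.simps) auto
qed simp

text \<open>Descent on the period: the letters at even positions alternate, which forces
  \<open>p div 2\<close> to be even, and those at odd positions form \<open>paperfold\<close> again,
  which inherits a square of period \<open>p div 2\<close>.\<close>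

lemma paperfold_no_even_square:
  assumes "even p"
  shows "\<not> square_from paperfold c p"
  using assms
proof (induction "nat p" arbitrary: c p rule: less_induct)
  case less
  obtain q where q: "p = 2 * q" using \<open>even p\<close> by blast
  show ?case
  proof
    assume sq: "square_from paperfold c p"
    then have "0 < q" by (simp add: square_from_def q)
    \<comment> \<open>One even position among the first two of the square suffices; it lies in the
      first half because \<open>p\<close> is at least 2.\<close>
    obtain m where m: "c \<le> 2 * m" "2 * m < c + 2"
      by (rule that[of "(c + 1) div 2"]) auto
    have "paperfold (2 * m) = paperfold (2 * (m + q))"
      using square_fromD[OF sq, of "2 * m"] m \<open>0 < q\<close> by (simp add: q algebra_simps)
    then have "even q" unfolding paperfold_even even_add by blast
    have "square_from paperfold (c div 2) q"
      unfolding square_from_def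
    proof (intro conjI allI impI)
      fix k assume k: "c div 2 \<le> k" "k < c div 2 + q"
      have "paperfold (2 * k + 1) = paperfold (2 * (k + q) + 1)"
        using square_fromD[OF sq, of "2 * k + 1"] k by (simp add: q algebra_simps)
      then show "paperfold k = paperfold (k + q)" by (simp only: paperfold_odd)
    qed fact
    with less.hyps[of q] \<open>even q\<close> \<open>0 < q\<close> show False by (simp add: q)
  qed
qed

definition parity_paperfold :: "int \<Rightarrow> bool \<times> bool" where
  "parity_paperfold n = (paperfold n, even n)"

lemma parity_paperfold_squarefree: "\<not> square_from parity_paperfold c p"
proof
  assume sq: "square_from parity_paperfold c p"
  then have "parity_paperfold c = parity_paperfold (c + p)"
    by (simp add: square_from_def)
  then have "even p" by (auto simp: parity_paperfold_def)
  moreover have "square_from paperfold c p"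
    using sq by (simp add: square_from_def parity_paperfold_def)
  ultimately show False using paperfold_no_even_square by blast
qed


section \<open>Inserting a separator at growing distances\<close>

text \<open>Gap \<open>i\<close> shows the factor of \<open>s\<close> strictly between
  \<open>P i - c i\<close> and \<open>P (Suc i) - c i\<close>; by \<open>left\<close> and
  \<open>right\<close> this window grows by one letter on either side. Position 0 is excluded
  because the first gap may be empty, as in \<open>word_y\<close>, where two separators are then
  adjacent.\<close>

lemma squarefree_with_separators:
  fixes Z :: "nat \<Rightarrow> 'a option" and s :: "int \<Rightarrow> 'a" and P :: "nat \<Rightarrow> nat" and c :: "nat \<Rightarrow> int"
  assumes s: "\<And>c p. \<not> square_from s c p"
    and P0: "P 0 = 0" and P_less: "\<And>i. P i < P (Suc i)"
    and left: "\<And>i. int (P (Suc i)) - c (Suc i) = int (P i) - c i - 1"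
    and right: "\<And>i. int (P (Suc (Suc i))) - c (Suc i) = int (P (Suc i)) - c i + 1"
    and sep: "\<And>i. Z (P i) = None"
    and nonsep: "\<And>i k. P i < k \<Longrightarrow> k < P (Suc i) \<Longrightarrow> Z k = Some (s (int k - c i))"
    and t: "1 \<le> t"
  shows "\<not> square_from Z t p"
proof
  assume sq: "square_from Z t p"
  then have "0 < p" by (simp add: square_from_def)
  note eq = square_fromD[OF sq]
  have mono: "strict_mono P" using P_less by (simp add: strict_mono_Suc_iff)
  have locate: "\<exists>i. P i \<le> k \<and> k < P (Suc i)" for k
  proof (induction k)
    case 0
    then show ?case using P0 P_less[of 0] by (intro exI[of _ 0]) simp
  next
    case (Suc k)
    then obtain i where "P i \<le> k" "k < P (Suc i)" by blast
    then show ?case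
      using P_less[of "Suc i"] by (cases "Suc k < P (Suc i)") (auto intro: exI[of _ i] exI[of _ "Suc i"])
  qed
  have sep_iff: "Z k = None \<longleftrightarrow> k \<in> range P" for k
  proof
    assume "Z k = None"
    moreover obtain i where "P i \<le> k" "k < P (Suc i)" using locate by blast
    ultimately show "k \<in> range P" using nonsep[of i k] by (cases "P i = k") auto
  qed (auto simp: sep)
  define g where "g i = P (Suc i) - P i" for i
  have g_Suc: "g (Suc i) = g i + 2" for i
    using left[of i] right[of i] P_less[of i] P_less[of "Suc i"] by (simp add: g_def)
  have g_mono: "strict_mono g" by (simp add: strict_mono_Suc_iff g_Suc)
  \<comment> \<open>\<open>P i0\<close> is the last separator before the square, \<open>P i\<close>
    the first one at or after its start.\<close>
  obtain i0 where i0: "P i0 < t" "t \<le> P (Suc i0)"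
    using locate[of "t - 1"] t by (metis One_nat_def Suc_pred le_imp_less_Suc less_eq_Suc_le)
  define i where "i = Suc i0"
  have first: "P i \<le> P j" if "t \<le> P j" for j
  proof -
    have "i0 < j" using that i0 strict_mono_less[OF mono, of i0 j] by linarith
    then show ?thesis using strict_mono_less_eq[OF mono] by (simp add: i_def)
  qed
  show False
  proof (cases "P i < t + p")
    case False
    \<comment> \<open>no separator in the first half of the square, hence none at all\<close>
    have none_first: "Z k \<noteq> None" if k: "t \<le> k" "k < t + p" for k
    proof
      assume "Z k = None"
      then obtain l where "k = P l" by (auto simp: sep_iff)
      then show False using first[of l] False k by simp
    qed
    have none: "Z k \<noteq> None" if k: "t \<le> k" "k < t + p + p" for k
    proof (cases "k < t + p")
      case False
      then show ?thesis using eq[of "k - p"] none_first[of "k - p"] k by simp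
    qed (use none_first k in blast)
    have far: "t + p + p \<le> P i"
      using none[of "P i"] sep[of i] i0 by (intro leI notI) (simp add: i_def)
    have "square_from s (int t - c i0) (int p)"
      unfolding square_from_def
    proof (intro conjI allI impI)
      fix k assume k: "int t - c i0 \<le> k" "k < int t - c i0 + int p"
      obtain n where n: "k = int n - c i0" "t \<le> n" "n < t + p"
        by (rule that[of "nat (k + c i0)"]) (use k in auto)
      have "Z n = Z (n + p)" using eq n by simp
      then have "s (int n - c i0) = s (int (n + p) - c i0)"
        using nonsep[of i0 n] nonsep[of i0 "n + p"] n(2,3) i0 far by (simp add: i_def)
      moreover have "int (n + p) - c i0 = k + int p" using n(1) by simp
      ultimately show "s k = s (k + int p)" using n(1) by metis
    qed (use \<open>0 < p\<close> in simp)
    with s show False by blast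
  next
    case True
    have ti: "t \<le> P i" using i0 by (simp add: i_def)
    have "Z (P i + p) = None" using eq[OF ti True] sep by simp
    then obtain j where j: "P j = P i + p" by (auto simp: sep_iff)
    then have "i < j" using strict_mono_less[OF mono, of i j] \<open>0 < p\<close> by simp
    show False
    proof (cases "P (Suc i) < t + p")
      case True
      \<comment> \<open>the distance between the first two separators is repeated later\<close>
      have "Z (P (Suc i) + p) = None"
        using eq[of "P (Suc i)"] True ti P_less[of i] sep by simp
      then obtain l where l: "P l = P (Suc i) + p" by (auto simp: sep_iff)
      then have "P j < P l" using j P_less[of i] by simp
      then have "Suc j \<le> l" using strict_mono_less[OF mono] by simp
      then have "P (Suc j) \<le> P l" using strict_mono_less_eq[OF mono] by simp
      then have "g j \<le> g i" using l j by (simp add: g_def)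
      then show False using strict_mono_less[OF g_mono, of i j] \<open>i < j\<close> by simp
    next
      case False
      \<comment> \<open>each half contains exactly one separator\<close>
      have "Suc i \<le> j" using \<open>i < j\<close> by simp
      then have le: "P (Suc i) \<le> P i + p" using strict_mono_less_eq[OF mono] j by metis
      \<comment> \<open>One period before \<open>P (Suc i)\<close> there is again a separator, at or
        after \<open>t\<close> but not beyond \<open>P i\<close>. So it is
        \<open>P i\<close>.\<close>
      have "Z (P (Suc i) - p) = None"
        using eq[of "P (Suc i) - p"] False le True ti sep[of "Suc i"] by simp
      then obtain l where "P (Suc i) - p = P l" by (auto simp: sep_iff)
      then have period: "P (Suc i) = P i + p"
        using first[of l] False le by linarith
      have "2 \<le> p" using g_Suc[of i0] period by (simp add: g_def i_def)
      \<comment> \<open>Since \<open>p\<close> is at least 2, the first half contains a neighbour of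
        \<open>P i\<close>. As the windows shift by one, this neighbour and its copy stem from
        adjacent letters of \<open>s\<close>, which would have to be equal.\<close>
      consider (suffix) "t < P i" | (prefix) "Suc (P i) < t + p"
        using ti True \<open>2 \<le> p\<close> by linarith
      then show False
      proof cases
        case suffix
        define n where "n = P i - 1"
        have n: "n < P i" "Suc n = P i" "t \<le> n" using suffix by (auto simp: n_def)
        have "P i0 < n" using i0 n by simp
        have "Z n = Z (n + p)" using eq[of n] n True by simp
        then have "s (int n - c i0) = s (int (n + p) - c i)"
          using nonsep[of i0 n] nonsep[of i "n + p"] \<open>P i0 < n\<close> n period \<open>2 \<le> p\<close>
          by (simp add: i_def)
        moreover have "int (n + p) - c i = int n - c i0 + 1"
          using right[of i0] period n(2) by (simp add: i_def)
        ultimately have "s (int n - c i0) = s (int n - c i0 + 1)" by (simp only:)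
        then have "square_from s (int n - c i0) 1" by (auto simp: square_from_def)
        with s show False by blast
      next
        case prefix
        have "P (Suc i) + 1 < P (Suc (Suc i))"
          using g_Suc[of i] by (simp add: g_def)
        moreover have "Z (Suc (P i)) = Z (Suc (P i) + p)"
          using eq[of "Suc (P i)"] prefix ti by simp
        ultimately have "s (int (Suc (P i)) - c i) = s (int (Suc (P (Suc i))) - c (Suc i))"
          using nonsep[of i "Suc (P i)"] nonsep[of "Suc i" "Suc (P (Suc i))"] period \<open>2 \<le> p\<close>
          by simp
        moreover have "int (Suc (P (Suc i))) - c (Suc i) = int (P i) - c i"
          "int (Suc (P i)) - c i = int (P i) - c i + 1"
          using left[of i] by simp_all
        ultimately have "s (int (P i) - c i) = s (int (P i) - c i + 1)" by (simp only:)
        then have "square_from s (int (P i) - c i) 1" by (auto simp: square_from_def)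
        with s show False by blast
      qed
    qed
  qed
qed

section \<open>The preimages of the two words\<close>

text \<open>Stretch \<open>i\<close> has length 2i + 1 and so fills the positions from i^2 up to
  (i+1)^2, exclusive; \<open>floor_sqrt\<close> finds the stretch of a position.\<close>

definition word_x :: "nat \<Rightarrow> (bool \<times> bool) option" where
  "word_x k = (let i = floor_sqrt k in
     if k = i\<^sup>2 + i then None
     else if k < i\<^sup>2 + i then Some (parity_paperfold (int k - (int i)\<^sup>2))
     else Some (parity_paperfold (int k - (int i + 1)\<^sup>2)))"

definition word_y :: "nat \<Rightarrow> (bool \<times> bool) option" where
  "word_y k = (let i = floor_sqrt k in
     if k = i\<^sup>2 then None else Some (parity_paperfold (int k - (int i)\<^sup>2 - int i - 1)))"

lemma floor_sqrt_square_add: "b \<le> 2 * i \<Longrightarrow> floor_sqrt (i\<^sup>2 + b) = i"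
  by (rule floor_sqrt_unique) (auto simp: power2_eq_square)

lemma word_x_square_add:
  assumes "b \<le> 2 * i"
  shows "word_x (i\<^sup>2 + b) =
    (if b = i then None
     else if b < i then Some (parity_paperfold (int b))
     else Some (parity_paperfold (int b - 2 * int i - 1)))"
  unfolding word_x_def floor_sqrt_square_add[OF assms] Let_def
  by (simp add: power2_eq_square algebra_simps)

lemma word_y_square_add:
  assumes "b \<le> 2 * i"
  shows "word_y (i\<^sup>2 + b) =
    (if b = 0 then None else Some (parity_paperfold (int b - int i - 1)))"
  unfolding word_y_def floor_sqrt_square_add[OF assms] Let_def by simp

lemma word_x_squarefree:
  assumes "1 \<le> t"
  shows "\<not> square_from word_x t p"
proof (rule squarefree_with_separators[where s = parity_paperfold
      and P = "\<lambda>i. i\<^sup>2 + i" and c = "\<lambda>i. (int i + 1)\<^sup>2"])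
  fix i k :: nat
  assume k: "i\<^sup>2 + i < k" "k < (Suc i)\<^sup>2 + Suc i"
  show "word_x k = Some (parity_paperfold (int k - (int i + 1)\<^sup>2))"
  \<comment> \<open>A gap straddles two stretches: s[-i..0) ends one and s[0..i+1) begins the next,
    so one offset serves both.\<close>
  proof (cases "k < (Suc i)\<^sup>2")
    case True
    define b where "b = k - i\<^sup>2"
    have b: "k = i\<^sup>2 + b" "i < b" "b \<le> 2 * i"
      using k True by (auto simp: b_def power2_eq_square)
    show ?thesis
      unfolding b(1) using b(2,3) word_x_square_add[of b i]
      by (simp add: power2_eq_square algebra_simps)
  next
    case False
    define b where "b = k - (Suc i)\<^sup>2"
    have b: "k = (Suc i)\<^sup>2 + b" "b < Suc i"
      using k False by (auto simp: b_def)
    show ?thesis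
      unfolding b(1) using b(2) word_x_square_add[of b "Suc i"]
      by (simp add: power2_eq_square algebra_simps)
  qed
next
  show "word_x (i\<^sup>2 + i) = None" for i
    using word_x_square_add[of i i] by simp
qed (use assms in \<open>auto simp: parity_paperfold_squarefree power2_eq_square algebra_simps\<close>)

lemma word_y_squarefree:
  assumes "1 \<le> t"
  shows "\<not> square_from word_y t p"
proof (rule squarefree_with_separators[where s = parity_paperfold
      and P = "\<lambda>i. i\<^sup>2" and c = "\<lambda>i. (int i)\<^sup>2 + int i + 1"])
  fix i k :: nat
  assume k: "i\<^sup>2 < k" "k < (Suc i)\<^sup>2"
  define b where "b = k - i\<^sup>2"
  have b: "k = i\<^sup>2 + b" "0 < b" "b \<le> 2 * i"
    using k by (auto simp: b_def power2_eq_square)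
  then show "word_y k = Some (parity_paperfold (int k - ((int i)\<^sup>2 + int i + 1)))"
    using word_y_square_add[of b i] by (simp add: algebra_simps)
next
  show "word_y (i\<^sup>2) = None" for i
    using word_y_square_add[of 0 i] by simp
qed (use assms in \<open>auto simp: parity_paperfold_squarefree power2_eq_square algebra_simps\<close>)


section \<open>Coding into binary words\<close>

text \<open>
  Found by computer search: every block starts with the marker 001, which occurs nowhere else in a
  concatenation of blocks, and a block is determined by its first six as well as by its last three
  letters.
\<close>

fun code :: "(bool \<times> bool) option \<Rightarrow> bool list" where
  "code None = [False, False, True, True, True, True, True, True, True]"
| "code (Some (False, False)) = [False, False, True, True, True, False, True, True, False]"
| "code (Some (False, True)) = [False, False, True, False, True, True, True, False, True]"
| "code (Some (True, False)) = [False, False, True, True, False, True, False, True, True]"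
| "code (Some (True, True)) = [False, False, True, False, True, False, True, False, False]"

definition letters :: "(bool \<times> bool) option list" where
  "letters = [None, Some (False, False), Some (False, True), Some (True, False), Some (True, True)]"

lemma in_letters: "a \<in> set letters"
  by (cases a) (auto simp: letters_def)

lemma length_code [simp]: "length (code a) = 9"
  by (cases a rule: code.cases) auto

lemma code_prefix_inj: "take 6 (code a) = take 6 (code b) \<Longrightarrow> a = b"
  by (cases a rule: code.cases; cases b rule: code.cases) simp_all

lemma code_suffix_inj: "drop 6 (code a) = drop 6 (code b) \<Longrightarrow> a = b"
  by (cases a rule: code.cases; cases b rule: code.cases) simp_all

text \<open>The appended letters begin the next block, so occurrences across the border are
  covered.\<close>

lemma marker_check:
  "\<forall>a \<in> set letters. \<forall>r \<in> set [1..<9].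
     take 3 (drop r (code a @ [False, False, True])) \<noteq> [False, False, True]"
  by code_simp

text \<open>A square of period at most 10 that starts in the first block ends within 28 letters:
  three blocks and the first letter of a fourth, always \<open>False\<close>. Period 9 is left to
  the argument for multiples of the block length.\<close>

lemma short_square_check:
  "\<forall>p \<in> set [4, 5, 6, 7, 8, 10].
   \<forall>a \<in> set letters. \<forall>b \<in> set letters. \<forall>c \<in> set letters. a \<noteq> b \<longrightarrow> b \<noteq> c \<longrightarrow>
     (let w = code a @ code b @ code c @ [False] in
      \<forall>r \<in> set [0..<9]. take p (drop r w) \<noteq> take p (drop (r + p) w))"
  by code_simp

definition encode :: "(nat \<Rightarrow> (bool \<times> bool) option) \<Rightarrow> bool word" where
  "encode Z k = code (Z (k div 9)) ! (k mod 9)"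

lemma encode_block: "j < 9 \<Longrightarrow> encode Z (9 * k + j) = code (Z k) ! j"
  by (simp add: encode_def)

lemma code_marker: "\<not> code a ! 0" "\<not> code a ! Suc 0" "code a ! Suc (Suc 0)"
  by (cases a rule: code.cases; simp)+

text \<open>A period divisible by 9 yields a square in \<open>Z\<close>; any other period from 11 on
  moves a whole marker off the block borders; the remaining ones are checked by computation. The
  bound on \<open>t\<close> skips block 0, where \<open>Z\<close> may have a square.\<close>

lemma encode_no_long_square:
  assumes Z: "\<And>k q. 1 \<le> k \<Longrightarrow> \<not> square_from Z k q" and t: "9 \<le> t" and p: "4 \<le> p"
  shows "\<not> square_from (encode Z) t p"
proof
  assume sq: "square_from (encode Z) t p"
  note eq = square_fromD[OF sq]
  define k where "k = t div 9"
  define r where "r = t mod 9"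
  have tkr: "t = 9 * k + r" and r: "r < 9" and k: "1 \<le> k"
    using t by (auto simp: k_def r_def)
  have neq: "Z l \<noteq> Z (Suc l)" if "1 \<le> l" for l
    using Z[of l 1] that by (auto simp: square_from_def le_less_Suc_eq)
  consider (aligned) "9 dvd p" | (long) "\<not> 9 dvd p" "11 \<le> p" | (short) "\<not> 9 dvd p" "p \<le> 10"
    by linarith
  then show False
  proof cases
    case aligned
    then obtain q where q: "p = 9 * q" by blast
    then have "0 < q" using p by simp
    have shifted: "code (Z l) ! j = code (Z (l + q)) ! j"
      if "j < 9" "t \<le> 9 * l + j" "9 * l + j < t + p" for l j
      using eq[OF that(2,3)] encode_block[OF that(1), of Z l] encode_block[OF that(1), of Z "l + q"]
      by (simp add: q algebra_simps)
    have inner: "Z l = Z (l + q)" if "k < l" "l < k + q" for l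
    proof (rule code_prefix_inj, rule nth_equalityI)
      fix j assume "j < length (take 6 (code (Z l)))"
      then show "take 6 (code (Z l)) ! j = take 6 (code (Z (l + q))) ! j"
        using shifted[of j l] that r by (simp add: tkr q)
    qed simp
    show False
    \<comment> \<open>Either the last three letters of block \<open>k\<close> belong to the square,
      and the repetition in \<open>Z\<close> starts at \<open>k\<close>, or the first half reaches
      past the first six letters of block \<open>k + q\<close>, and it starts at
      \<open>Suc k\<close>.\<close>
    proof (cases "r \<le> 6")
      case True
      have "Z k = Z (k + q)"
      proof (rule code_suffix_inj, rule nth_equalityI)
        fix j assume "j < length (drop 6 (code (Z k)))"
        then show "drop 6 (code (Z k)) ! j = drop 6 (code (Z (k + q))) ! j"
          using shifted[of "6 + j" k] True \<open>0 < q\<close> by (simp add: tkr q)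
      qed simp
      then have "square_from Z k q"
        using inner \<open>0 < q\<close> by (auto simp: square_from_def le_less)
      with Z k show False by blast
    next
      case False
      have "Z (k + q) = Z (k + q + q)"
      proof (rule code_prefix_inj, rule nth_equalityI)
        fix j assume "j < length (take 6 (code (Z (k + q))))"
        then show "take 6 (code (Z (k + q))) ! j = take 6 (code (Z (k + q + q))) ! j"
          using shifted[of j "k + q"] False r \<open>0 < q\<close> by (simp add: tkr q)
      qed simp
      then have "square_from Z (Suc k) q"
        using inner \<open>0 < q\<close> by (auto simp: square_from_def Suc_le_eq less_Suc_eq)
      with Z[of "Suc k"] show False by simp
    qed
  next
    case long
    \<comment> \<open>The first block border at or after \<open>t\<close> is at most 8 letters away,
      so its marker of length 3 fits into a first half of length 11.\<close>
    define l where "l = (t + 8) div 9"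
    have l: "t \<le> 9 * l" "9 * l + 2 < t + p"
      using long(2) by (auto simp: l_def)
    define a where "a = (9 * l + p) div 9"
    define b where "b = p mod 9"
    have b: "9 * l + p = 9 * a + b" "b < 9" "1 \<le> b"
      using long(1) by (auto simp: a_def b_def dvd_eq_mod_eq_0)
    define w where "w = code (Z a) @ [False, False, True]"
    have w: "encode Z (9 * a + i) = w ! i" if "i < 12" for i
    proof (cases "i < 9")
      case True
      then show ?thesis by (simp add: encode_block w_def nth_append)
    next
      case False
      define j where "j = i - 9"
      have "i = 9 + j" "j < 3"
        using False that by (auto simp: j_def)
      then show ?thesis
        using encode_block[of j Z "Suc a"]
        by (auto simp: w_def nth_append less_Suc_eq numeral_3_eq_3 code_marker algebra_simps)
    qed
    have "encode Z (9 * l + j) = encode Z (9 * a + (b + j))" if "j < 3" for j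
      using eq[of "9 * l + j"] l b that by (simp add: algebra_simps)
    then have "w ! (b + j) = code (Z l) ! j" if "j < 3" for j
      using that w[of "b + j"] b encode_block[of j Z l] by simp
    moreover have "length w = 12" by (simp add: w_def)
    ultimately have "take 3 (drop b w) = take 3 (code (Z l))"
      using b by (intro nth_equalityI) simp_all
    also have "\<dots> = [False, False, True]"
      by (cases "Z l" rule: code.cases) simp_all
    finally show False
      using marker_check in_letters[of "Z a"] b by (simp add: w_def)
  next
    case short
    define w where "w = code (Z k) @ code (Z (Suc k)) @ code (Z (Suc (Suc k))) @ [False]"
    have w: "encode Z (9 * k + i) = w ! i" if "i < 28" for i
    proof -
      have split: "i < 9 \<or> (\<exists>j<9. i = 9 + j) \<or> (\<exists>j<9. i = 18 + j) \<or> i = 27"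
        using that by presburger
      have "9 * k + (9 + j) = 9 * Suc k + j" "9 * k + (18 + j) = 9 * Suc (Suc k) + j"
        "9 * k + 27 = 9 * Suc (Suc (Suc k)) + 0" for j
        by simp_all
      with split show ?thesis
        by (elim disjE exE conjE; hypsubst?; simp only: encode_block zero_less_numeral)
          (simp_all add: w_def nth_append code_marker)
    qed
    have len: "length w = 28" by (simp add: w_def)
    have "take p (drop r w) = take p (drop (r + p) w)"
    proof (rule nth_equalityI)
      fix j assume "j < length (take p (drop r w))"
      then have "j < p" by simp
      then show "take p (drop r w) ! j = take p (drop (r + p) w) ! j"
        using eq[of "9 * k + r + j"] w[of "r + j"] w[of "r + p + j"] r short(2) len
        by (simp add: tkr add_ac)
    qed (use r short(2) len in simp)
    moreover have "p \<in> set [4, 5, 6, 7, 8, 10]"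
    proof -
      have "p \<noteq> 9" using short by auto
      then show ?thesis using p short(2) by auto
    qed
    moreover have "r \<in> set [0..<9]" using r by simp
    moreover have "Z (Suc k) \<noteq> Z (Suc (Suc k))" using neq by simp
    ultimately show False
      using short_square_check in_letters neq[OF k] unfolding w_def Let_def by blast
  qed
qed

section \<open>Squares in the shuffle and the final words\<close>

lemma square_from_shift:
  fixes w :: "'a word"
  assumes "square_from (\<lambda>j. w (j + c)) t p"
  shows "square_from w (t + c) p"
  unfolding square_from_def
proof (intro conjI allI impI)
  fix k assume "t + c \<le> k" "k < t + c + p"
  then show "w k = w (k + p)"
    using square_fromD[OF assms, of "k - c"] by simp
qed (use assms in \<open>simp add: square_from_def\<close>)

text \<open>From position \<open>m\<close> on, \<open>x\<close> reads uv and \<open>y\<close> reads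
  vu with |u| = k + 1 and |v| = k. An odd period exchanges even and odd positions, so every
  comparison is between a letter of \<open>x\<close> and one of \<open>y\<close>.\<close>

lemma shuffle_square:
  assumes x: "\<And>j. j \<le> k \<Longrightarrow> x (m + j) = y (m + k + j)"
    and y: "\<And>j. j < k \<Longrightarrow> y (m + j) = x (m + k + 1 + j)"
  shows "square_from (x SH y) (2 * m) (2 * k + 1)"
  unfolding square_from_def
proof (intro conjI allI impI)
  fix n assume n: "2 * m \<le> n" "n < 2 * m + (2 * k + 1)"
  then obtain i where i: "n = 2 * m + i" "i < 2 * k + 1"
    by (metis add_less_cancel_left le_Suc_ex)
  show "(x SH y) n = (x SH y) (n + (2 * k + 1))"
  proof (cases "even i")
    case True
    then obtain j where "i = 2 * j" by blast
    then show ?thesis using x[of j] i by (simp add: perfect_shuffle_def add_ac)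
  next
    case False
    then obtain j where "i = 2 * j + 1" by (rule oddE)
    moreover have "(2 * m + (2 * j + 1) + (2 * k + 1)) div 2 = m + k + 1 + j" by simp
    ultimately show ?thesis using y[of j] i by (simp add: perfect_shuffle_def add_ac)
  qed
qed simp

theorem theorem13:
  shows "\<exists>x y :: bool word.
    \<not> (\<exists>w. 4 \<le> length w \<and> contains_square x w) \<and>
    \<not> (\<exists>w. 4 \<le> length w \<and> contains_square y w) \<and>
    (\<forall>N. \<exists>w. N \<le> length w \<and> contains_square (x SH y) w)"
proof -
  \<comment> \<open>Dropping 9 letters skips block 0. The further 5 letters in \<open>y\<close> cut
    a separator block into 5 and 4: u ends with its first 5 letters, v begins with its last
    4.\<close>
  define x where "x j = encode word_x (j + 9)" for j
  define y where "y j = encode word_y (j + 14)" for j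
  have "\<not> square_from x t p" if "4 \<le> p" for t p
    using encode_no_long_square[OF word_x_squarefree, of "t + 9" p] that
      square_from_shift[of "encode word_x" 9 t p] by (auto simp: x_def[abs_def])
  then have no_x: "\<not> (\<exists>w. 4 \<le> length w \<and> contains_square x w)"
    using contains_square_imp_square_from by blast
  have "\<not> square_from y t p" if "4 \<le> p" for t p
    using encode_no_long_square[OF word_y_squarefree, of "t + 14" p] that
      square_from_shift[of "encode word_y" 14 t p] by (auto simp: y_def[abs_def])
  then have no_y: "\<not> (\<exists>w. 4 \<le> length w \<and> contains_square y w)"
    using contains_square_imp_square_from by blast
  have "\<exists>w. N \<le> length w \<and> contains_square (x SH y) w" for N
  proof -
    \<comment> \<open>Taking \<open>i\<close> positive makes the subtraction in \<open>m\<close>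
      exact; \<open>m\<close> is where the code of stretch \<open>i\<close> begins in
      \<open>x\<close>.\<close>
    define i where "i = Suc N"
    define m where "m = 9 * i\<^sup>2 - 9"
    have m: "m + 9 = 9 * i\<^sup>2" by (simp add: m_def i_def)
    have "square_from (x SH y) (2 * m) (2 * (9 * i + 4) + 1)"
    proof (rule shuffle_square)
      fix j assume j: "j \<le> 9 * i + 4"
      define b where "b = j div 9"
      define e where "e = j mod 9"
      have be: "j = 9 * b + e" "e < 9" "b \<le> i" using j by (auto simp: b_def e_def)
      have "word_x (i\<^sup>2 + b) = word_y (i\<^sup>2 + i + 1 + b)"
      \<comment> \<open>At the end of u both words show a separator: the middle of stretch
        \<open>i\<close> in \<open>word_x\<close>, the start of stretch \<open>Suc i\<close> in
        \<open>word_y\<close>.\<close>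
      proof (cases "b = i")
        case True
        have "i\<^sup>2 + i + 1 + i = (Suc i)\<^sup>2 + 0" by (simp add: power2_eq_square)
        then show ?thesis
          using True word_x_square_add[of b i] word_y_square_add[of 0 "Suc i"] by simp
      next
        case False
        then show ?thesis
          using be word_x_square_add[of b i] word_y_square_add[of "i + 1 + b" i]
          by (simp add: add_ac)
      qed
      moreover have "x (m + j) = encode word_x (9 * (i\<^sup>2 + b) + e)"
      proof -
        have "m + j + 9 = 9 * (i\<^sup>2 + b) + e" using m be by simp
        then show ?thesis by (simp only: x_def)
      qed
      moreover have "y (m + (9 * i + 4) + j) = encode word_y (9 * (i\<^sup>2 + i + 1 + b) + e)"
      proof -
        have "m + (9 * i + 4) + j + 14 = 9 * (i\<^sup>2 + i + 1 + b) + e"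
          using m be by simp
        then show ?thesis by (simp only: y_def)
      qed
      ultimately show "x (m + j) = y (m + (9 * i + 4) + j)"
        using be by (simp only: encode_block)
    next
      fix j assume j: "j < 9 * i + 4"
      \<comment> \<open>At \<open>m\<close> the word \<open>y\<close> is already 5 letters into the
        separator block of stretch \<open>i\<close>, hence \<open>j + 5\<close>.\<close>
      define b where "b = (j + 5) div 9"
      define e where "e = (j + 5) mod 9"
      have be: "j + 5 = 9 * b + e" "e < 9" "b \<le> i" using j by (auto simp: b_def e_def)
      have "word_y (i\<^sup>2 + b) = word_x (i\<^sup>2 + (i + b))"
        using be word_y_square_add[of b i] word_x_square_add[of "i + b" i] by simp
      moreover have "y (m + j) = encode word_y (9 * (i\<^sup>2 + b) + e)"
      proof -
        have "m + j + 14 = 9 * (i\<^sup>2 + b) + e" using m be by simp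
        then show ?thesis by (simp only: y_def)
      qed
      moreover have "x (m + (9 * i + 4) + 1 + j) = encode word_x (9 * (i\<^sup>2 + (i + b)) + e)"
      proof -
        have "m + (9 * i + 4) + 1 + j + 9 = 9 * (i\<^sup>2 + (i + b)) + e" using m be by simp
        then show ?thesis by (simp only: x_def)
      qed
      ultimately show "y (m + j) = x (m + (9 * i + 4) + 1 + j)"
        using be by (simp only: encode_block)
    qed
    from square_from_imp_contains_square[OF this] show ?thesis
      by (intro exI conjI) (auto simp: i_def)
  qed
  with no_x no_y show ?thesis by blast
qed

end
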